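(* Letting $n\to\infty$ through the even integers, $$\lim_{n\to\infty}\frac{C_{\mathbb{C},n}}{C_{\mathbb{C},n-2}}=2^{\frac14}\cdot\lim_{n\to\infty}\frac{r_n}{r_{n-2}},$$ in the sense that one limit exists if and only if the other does, and then the equality holds. In particular, if the sequence $\{r_n\}$ (indexed by the even positive integers) is convergent, then, with $n\to\infty$ through all integers, $$\lim_{n\to\infty}\frac{C_{\mathbb{C},n}}{C_{\mathbb{C},n-1}}=2^{\frac18}.$$
   Context: For $p>0$ put $A_p=\sqrt{2}\left(\frac{\Gamma((p+1)/2)}{\sqrt{\pi}}\right)^{1/p}$, where $\Gamma$ is the Gamma function. The real numbers $C_{\mathbb{C},n}$, $n\ge 2$ (estimates for the constants in the complex Bohnenblust--Hille inequality), are defined recursively by $C_{\mathbb{C},2}=\frac{2}{\sqrt{\pi}}$, $C_{\mathbb{C},3}=\left(\frac{2}{\sqrt{\pi}}\right)^{2}$, and $$C_{\mathbb{C},n}=\frac{2^{\frac{n+2}{2n}}}{\pi^{1/n}}\left(\frac{1}{A_{\frac{2n-4}{n-1}}^{2}}\right)^{\frac{n-2}{n}}\left(C_{\mathbb{C},n-2}\right)^{\frac{n-2}{n}}\quad\text{for } n\ge 4.$$ For even positive integers $n$ define $$r_n=\frac{1}{2^{\frac{n-2}{4}}\left[\prod_{k=1}^{\frac{n-2}{2}}\left(\frac{\Gamma\left(\frac{6k+1}{4k+2}\right)}{\sqrt{\pi}}\right)^{2k+1}\right]^{1/n}}$$ (an empty product equals $1$). *)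

theory Defs
  imports "HOL-Analysis.Analysis"
begin

definition A_const :: "real \<Rightarrow> real" where
  "A_const p = sqrt 2 * (Gamma ((p + 1) / 2) / sqrt pi) powr (1 / p)"

(* The constants are only meaningful for n >= 2; the value 0 for n < 2 is a dummy,
   and the recursion never reaches it. *)
fun C_BH :: "nat \<Rightarrow> real" where
  "C_BH n =
    (if n < 2 then 0
     else if n = 2 then 2 / sqrt pi
     else if n = 3 then (2 / sqrt pi)\<^sup>2
     else 2 powr ((real n + 2) / (2 * real n)) / pi powr (1 / real n)
          * (1 / (A_const ((2 * real n - 4) / (real n - 1)))\<^sup>2) powr ((real n - 2) / real n)
          * C_BH (n - 2) powr ((real n - 2) / real n))"

declare C_BH.simps [simp del]

(* Only meaningful for even n >= 2. *)
definition r_seq :: "nat \<Rightarrow> real" where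
  "r_seq n =
    1 / (2 powr ((real n - 2) / 4)
         * (\<Prod>k = 1..(n - 2) div 2.
              (Gamma ((6 * real k + 1) / (4 * real k + 2)) / sqrt pi) ^ (2 * k + 1))
           powr (1 / real n))"

(* n tends to infinity through the even integers *)
definition even_at_top :: "nat filter" where
  "even_at_top = inf at_top (principal {n. even n})"

end

theory Submission
  imports Defs "HOL-Real_Asymp.Real_Asymp"
begin

text \<open>Put \<open>g(n) = ln (\<Gamma>((3n-5)/(2n-2)) / \<surd>\<pi>)\<close>. Multiplied by \<open>n\<close>, the logarithm of the recursion
  becomes additive:
  \<open>n ln C\<^sub>n = (n-2) ln C\<^sub>n\<^sub>-\<^sub>2 + (3 - n/2) ln 2 - ln \<pi> - (n-1) g(n)\<close>. Since \<open>n ln r\<^sub>n\<close> has increments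
  \<open>-(n-2) ln 2 - (n-1) g(n)\<close>, one gets \<open>C\<^sub>n = r\<^sub>n 2\<^bsup>n/8+3/4\<^esup> / \<surd>\<pi>\<close> for even \<open>n\<close>, hence the exact identity
  \<open>C\<^sub>n / C\<^sub>n\<^sub>-\<^sub>2 = 2\<^bsup>1/4\<^esup> r\<^sub>n / r\<^sub>n\<^sub>-\<^sub>2\<close>. Moreover the argument of \<open>\<Gamma>\<close> is \<open>3/2 - 1/(n-1)\<close> and
  \<open>\<Gamma>(3/2) = \<surd>\<pi>/2\<close>, so \<open>(n-1) (g(n) + ln 2)\<close> converges because \<open>\<Gamma>\<close> is differentiable at \<open>3/2\<close>.
  Thus \<open>n ln C\<^sub>n - n\<^sup>2 ln 2 / 8\<close> has convergent two-step increments, and by Cesaro averaging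
  \<open>ln C\<^sub>n - n ln 2 / 8\<close> converges.\<close>

section \<open>Logarithmic form of the recursion\<close>

definition lnG :: "nat \<Rightarrow> real" where
  "lnG n = ln (Gamma ((3 * real n - 5) / (2 * real n - 2)) / sqrt pi)"

lemma C_BH_pos:
  assumes "n \<ge> 2"
  shows "C_BH n > 0"
  using assms
proof (induction n rule: less_induct)
  case (less n)
  show ?case
  proof (cases "n \<ge> 4")
    case True
    have "C_BH (n - 2) > 0" using True by (intro less.IH) auto
    moreover have "Gamma (((2 * real n - 4) / (real n - 1) + 1) / 2) > 0"
      using True by (intro Gamma_real_pos divide_pos_pos add_pos_pos) auto
    ultimately show ?thesis
      using True by (subst C_BH.simps) (simp add: A_const_def)
  next
    case False
    then have "n = 2 \<or> n = 3" using less.prems by auto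
    then show ?thesis by (subst C_BH.simps) auto
  qed
qed

lemma ln_C_BH_rec:
  assumes "n \<ge> 4"
  shows "real n * ln (C_BH n) = (real n - 2) * ln (C_BH (n - 2))
           + (3 - real n / 2) * ln 2 - ln pi - (real n - 1) * lnG n"
proof -
  define x where "x = real n"
  have x: "x \<ge> 4" using assms by (simp add: x_def)
  define p where "p = (2 * x - 4) / (x - 1)"
  define G where "G = Gamma ((p + 1) / 2) / sqrt pi"
  have p: "p > 0" using x by (simp add: p_def)
  then have G: "G > 0" by (auto simp: G_def intro!: divide_pos_pos Gamma_real_pos)
  have "(p + 1) / 2 = (3 * x - 5) / (2 * x - 2)"
    using x by (simp add: p_def divide_simps)
  then have lnG: "lnG n = ln G" by (simp only: lnG_def G_def x_def)
  have A: "ln (A_const p) = ln 2 / 2 + ln G / p"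
    using G by (simp add: A_const_def G_def[symmetric] ln_mult ln_sqrt ln_powr)
  have A0: "A_const p > 0"
    using G by (simp add: A_const_def G_def[symmetric])
  have C: "C_BH (n - 2) > 0" using assms by (intro C_BH_pos) auto
  have eq: "C_BH n = 2 powr ((x + 2) / (2 * x)) / pi powr (1 / x)
          * (1 / (A_const p)\<^sup>2) powr ((x - 2) / x) * C_BH (n - 2) powr ((x - 2) / x)"
    using assms by (subst C_BH.simps) (simp add: x_def p_def)
  have "ln (C_BH n) = (x + 2) / (2 * x) * ln 2 - ln pi / x
          - (x - 2) / x * (2 * ln (A_const p)) + (x - 2) / x * ln (C_BH (n - 2))"
    unfolding eq using A0 C by (simp add: ln_mult ln_div ln_powr ln_realpow)
  then have "x * ln (C_BH n) = x * \<dots>" by (rule arg_cong)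
  also have "\<dots> = (x + 2) / 2 * ln 2 - ln pi
          - 2 * (x - 2) * ln (A_const p) + (x - 2) * ln (C_BH (n - 2))"
    using x by (simp add: field_simps)
  \<comment> \<open>The exponent 1/p = (x - 1) / (2 (x - 2)) inside \<open>A_const\<close> cancels
    the weight 2 (x - 2), so \<open>ln G\<close> keeps only the coefficient x - 1.\<close>
  also have "2 * (x - 2) * ln (A_const p) = (x - 2) * ln 2 + (x - 1) * ln G"
    unfolding A using x by (simp add: p_def divide_simps) (simp add: algebra_simps)
  finally show ?thesis by (simp add: lnG x_def field_simps)
qed

section \<open>Comparison of C_n and r_n at even indices\<close>

lemma Gamma_factor_pos: "Gamma ((6 * real k + 1) / (4 * real k + 2)) / sqrt pi > 0"
  by (intro divide_pos_pos Gamma_real_pos) auto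

lemma r_seq_pos: "r_seq n > 0"
proof -
  define P where "P = (\<Prod>k = 1..(n - 2) div 2.
          (Gamma ((6 * real k + 1) / (4 * real k + 2)) / sqrt pi) ^ (2 * k + 1))"
  have "P > 0"
    unfolding P_def by (intro prod_pos ballI zero_less_power Gamma_factor_pos)
  then show ?thesis unfolding r_seq_def P_def[symmetric] by simp
qed

text \<open>The k-th factor of the product belongs to the index n = 2k + 2: there (3n-5)/(2n-2) =
  (6k+1)/(4k+2) and n - 1 = 2k + 1. These are the terms (n-1) \<open>lnG n\<close> that the
  recursion subtracts.\<close>

lemma ln_r_seq:
  assumes "m \<ge> 1"
  shows "real (2 * m) * ln (r_seq (2 * m)) =
           - (real m * (real m - 1) * ln 2) - (\<Sum>k = 1..m - 1. (2 * real k + 1) * lnG (2 * k + 2))"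
proof -
  define P where "P = (\<Prod>k = 1..m - 1.
    (Gamma ((6 * real k + 1) / (4 * real k + 2)) / sqrt pi) ^ (2 * k + 1))"
  have P: "P > 0"
    unfolding P_def by (intro prod_pos ballI zero_less_power Gamma_factor_pos)
  have "ln P = (\<Sum>k = 1..m - 1.
          ln ((Gamma ((6 * real k + 1) / (4 * real k + 2)) / sqrt pi) ^ (2 * k + 1)))"
    unfolding P_def
    by (rule ln_prod) (simp, metis Gamma_factor_pos zero_less_power less_irrefl)
  also have "\<dots> = (\<Sum>k = 1..m - 1. (2 * real k + 1) * lnG (2 * k + 2))"
  proof (intro sum.cong refl)
    fix k
    have "(3 * real (2 * k + 2) - 5) / (2 * real (2 * k + 2) - 2) = (6 * real k + 1) / (4 * real k + 2)"
      by (simp add: algebra_simps)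
    then show "ln ((Gamma ((6 * real k + 1) / (4 * real k + 2)) / sqrt pi) ^ (2 * k + 1)) =
        (2 * real k + 1) * lnG (2 * k + 2)"
      unfolding lnG_def by (subst ln_realpow) simp
  qed
  finally have lnP: "ln P = (\<Sum>k = 1..m - 1. (2 * real k + 1) * lnG (2 * k + 2))" .
  have "(2 * m - 2) div 2 = m - 1" by simp
  then have "r_seq (2 * m) = 1 / (2 powr ((real (2 * m) - 2) / 4) * P powr (1 / real (2 * m)))"
    by (simp only: r_seq_def P_def)
  then have "ln (r_seq (2 * m)) = - ((real (2 * m) - 2) / 4 * ln 2 + 1 / real (2 * m) * ln P)"
    using P by (simp add: ln_div ln_mult ln_powr)
  then show ?thesis using assms by (simp add: lnP field_simps)
qed

text \<open>After multiplication by 2m both logarithms lose the same \<open>lnG\<close> term in the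
  step from m to m + 1, so their difference grows by (m + 2) ln 2 - ln pi. Summing from the value 2
  ln 2 - ln pi at m = 1 gives a quadratic in m that is divisible by m.\<close>

lemma ln_C_BH_even:
  assumes "m \<ge> 1"
  shows "ln (C_BH (2 * m)) = ln (r_seq (2 * m)) + (real m / 4 + 3 / 4) * ln 2 - ln pi / 2"
proof -
  have "real (2 * m) * ln (C_BH (2 * m)) = real (2 * m) * ln (r_seq (2 * m))
          + ((real m)\<^sup>2 / 2 + 3 * real m / 2) * ln 2 - real m * ln pi"
    using assms
  proof (induction m rule: dec_induct)
    case base
    have "C_BH 2 = 2 / sqrt pi" by (subst C_BH.simps) simp
    moreover have "r_seq 2 = 1" by (simp add: r_seq_def)
    ultimately show ?case by (simp add: ln_div ln_sqrt)
  next
    case (step m)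
    have "(\<Sum>k = 1..Suc m - 1. (2 * real k + 1) * lnG (2 * k + 2)) =
        (\<Sum>k = 1..m - 1. (2 * real k + 1) * lnG (2 * k + 2)) + (2 * real m + 1) * lnG (2 * m + 2)"
      using step(1) by (cases m) simp_all
    then have r: "real (2 * Suc m) * ln (r_seq (2 * Suc m)) =
        real (2 * m) * ln (r_seq (2 * m)) - 2 * real m * ln 2 - (2 * real m + 1) * lnG (2 * m + 2)"
      using ln_r_seq[of "Suc m"] ln_r_seq[of m] step(1) by (simp add: algebra_simps)
    have C: "real (2 * Suc m) * ln (C_BH (2 * Suc m)) = real (2 * m) * ln (C_BH (2 * m))
        + (2 - real m) * ln 2 - ln pi - (2 * real m + 1) * lnG (2 * m + 2)"
      using ln_C_BH_rec[of "2 * m + 2"] step(1) by (simp add: field_simps)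
    show ?case unfolding r C step.IH
      by (simp add: power2_eq_square field_simps)
  qed
  then have "real (2 * m) * ln (C_BH (2 * m)) = real (2 * m) *
      (ln (r_seq (2 * m)) + (real m / 4 + 3 / 4) * ln 2 - ln pi / 2)"
    by (simp add: power2_eq_square field_simps)
  then show ?thesis using assms by (subst (asm) mult_cancel_left) simp
qed

text \<open>From m - 1 to m the explicit term of \<open>ln_C_BH_even\<close> grows by ln 2 / 4,
  while the pi term cancels. The bound n \<ge> 4 keeps m - 1 \<ge> 1.\<close>

lemma C_BH_ratio_even:
  assumes "even n" "n \<ge> 4"
  shows "C_BH n / C_BH (n - 2) = 2 powr (1 / 4) * (r_seq n / r_seq (n - 2))"
proof -
  from assms obtain m where n: "n = 2 * m" by (elim evenE)
  then have n2: "n - 2 = 2 * (m - 1)" and m: "m \<ge> 2" using assms by auto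
  have pos: "C_BH n > 0" "C_BH (n - 2) > 0" "r_seq n > 0" "r_seq (n - 2) > 0"
    using assms by (auto intro: C_BH_pos r_seq_pos)
  have "ln (C_BH n / C_BH (n - 2)) = ln (2 powr (1 / 4) * (r_seq n / r_seq (n - 2)))"
    using ln_C_BH_even[of m] ln_C_BH_even[of "m - 1"] m pos
    by (simp add: ln_div ln_mult ln_powr n2 of_nat_diff n[symmetric]) (simp add: field_simps)
  moreover have "2 powr (1 / 4) * (r_seq n / r_seq (n - 2)) > 0" using pos by simp
  ultimately show ?thesis using pos by (metis ln_inj_iff divide_pos_pos)
qed

section \<open>Cesaro averaging and the asymptotics of ln C_n\<close>

lemma cesaro_two_step:
  fixes F :: "nat \<Rightarrow> real"
  assumes "(\<lambda>n. F (n + 2) - F n) \<longlonglongrightarrow> d"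
  shows "(\<lambda>n. F n / real n) \<longlonglongrightarrow> d / 2"
proof -
  \<comment> \<open>Removing the slope d/2 reduces the claim to two-step increments that tend to
    0.\<close>
  define H where "H n = F n - real n * (d / 2)" for n
  have "(\<lambda>n. F (n + 2) - F n - d) \<longlonglongrightarrow> 0"
    using tendsto_diff[OF assms tendsto_const[of d]] by simp
  then have lim: "(\<lambda>n. H (n + 2) - H n) \<longlonglongrightarrow> 0"
    by (simp add: H_def algebra_simps add_divide_distrib)
  have "(\<lambda>n. H n / real n) \<longlonglongrightarrow> 0"
  proof (rule LIMSEQ_I)
    fix e :: real assume e: "e > 0"
    from LIMSEQ_D[OF lim, of "e / 2"] e obtain N
      where N: "\<And>n. n \<ge> N \<Longrightarrow> \<bar>H (n + 2) - H n\<bar> < e / 2" by auto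
    \<comment> \<open>Steps of two preserve parity, so each parity class needs its own starting
      value.\<close>
    define K where "K = max \<bar>H N\<bar> \<bar>H (Suc N)\<bar>"
    have bound: "\<bar>H n\<bar> \<le> K + e / 2 * real n" if "n \<ge> N" for n
      using that
    proof (induction n rule: less_induct)
      case (less n)
      consider "n = N" | "n = Suc N" | "n \<ge> N + 2" using less.prems by linarith
      then show ?case
      proof cases
        case 3
        then have "\<bar>H (n - 2)\<bar> \<le> K + e / 2 * real (n - 2)" by (intro less.IH) auto
        moreover have "\<bar>H n - H (n - 2)\<bar> < e / 2" using N[of "n - 2"] 3
          by (simp del: add_2_eq_Suc' add_2_eq_Suc)
        moreover have "e / 2 * real (n - 2) = e / 2 * real n - e"
          using 3 by (simp add: algebra_simps)
        ultimately show ?thesis using e by linarith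
      qed (use e in \<open>auto simp: K_def intro: order_trans[OF _ le_add_same_cancel1[THEN iffD2]]\<close>)
    qed
    obtain M :: nat where M: "real M > 2 * K / e" using reals_Archimedean2 by blast
    show "\<exists>no. \<forall>n\<ge>no. norm (H n / real n - 0) < e"
    \<comment> \<open>\<open>M\<close> makes the constant \<open>K\<close> smaller than e/2 * n, and
      1 rules out division by zero.\<close>
    proof (intro exI[of _ "max (max N M) 1"] allI impI)
      fix n assume n: "max (max N M) 1 \<le> n"
      then have "2 * K / e < real n" using M by linarith
      then have "K < e / 2 * real n" using e by (simp add: field_simps)
      then have "\<bar>H n\<bar> < e * real n" using bound[of n] n by simp
      then show "norm (H n / real n - 0) < e" using n by (simp add: divide_simps)
    qed
  qed
  then have "(\<lambda>n. H n / real n + d / 2) \<longlonglongrightarrow> 0 + d / 2" by (intro tendsto_intros)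
  moreover have "\<forall>\<^sub>F n in sequentially. H n / real n + d / 2 = F n / real n"
    using eventually_gt_at_top[of 0] by eventually_elim (simp add: H_def field_simps)
  ultimately show ?thesis by (auto dest: Lim_transform_eventually)
qed

text \<open>With h = 1/(n+1) the expression is the difference quotient of \<open>f\<close> at 0: the
  Gamma argument at index n + 2 is 3/2 - h, and f(0) = -ln 2.\<close>

lemma lnG_asymp: "convergent (\<lambda>n. (real n + 1) * (lnG (n + 2) + ln 2))"
proof -
  define f where "f h = ln (Gamma (3 / 2 - h) / sqrt pi)" for h :: real
  have "Gamma (1 / 2 + 1 :: real) = 1 / 2 * Gamma (1 / 2)"
    by (rule Gamma_plus1) (auto elim!: nonpos_Ints_cases)
  then have G: "Gamma (3 / 2 :: real) = sqrt pi / 2"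
    by (simp add: Gamma_one_half_real)
  have f0: "f 0 = - ln 2"
    by (simp add: f_def G ln_div)
  have "\<exists>D. (f has_field_derivative D) (at 0)"
    unfolding f_def using G
    by (auto intro!: exI derivative_eq_intros simp: nonpos_Ints_def)
  then obtain D where "(f has_field_derivative D) (at 0)" ..
  then have "((\<lambda>h. (f h - f 0) / h) \<longlongrightarrow> D) (at 0)" by (simp add: DERIV_def)
  moreover have "filterlim (\<lambda>n. 1 / (real n + 1)) (at 0) sequentially"
    by real_asymp
  ultimately have "(\<lambda>n. (f (1 / (real n + 1)) - f 0) / (1 / (real n + 1))) \<longlonglongrightarrow> D"
    by (rule filterlim_compose)
  moreover have "(f (1 / (real n + 1)) - f 0) / (1 / (real n + 1))
      = (real n + 1) * (lnG (n + 2) + ln 2)" for n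
  proof -
    have "3 / 2 - 1 / (real n + 1) = (3 * real (n + 2) - 5) / (2 * real (n + 2) - 2)"
      by (simp add: divide_simps)
    then have "f (1 / (real n + 1)) = lnG (n + 2)" by (simp only: f_def lnG_def)
    then show ?thesis by (simp add: f0)
  qed
  ultimately show ?thesis by (simp only: convergent_def) blast
qed

lemma ln_C_BH_asymp: "convergent (\<lambda>n. ln (C_BH n) - real n * ln 2 / 8)"
proof -
  obtain D where D: "(\<lambda>n. (real n + 1) * (lnG (n + 2) + ln 2)) \<longlonglongrightarrow> D"
    using lnG_asymp by (auto simp: convergent_def)
  \<comment> \<open>Since \<open>lnG\<close> is close to -ln 2, the two-step increments of n ln C_n
    grow like (n/2) ln 2. Those of the quadratic term are (n+1)/2 * ln 2, which cancels this
    growth.\<close>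
  define F where "F n = real n * ln (C_BH n) - (real n)\<^sup>2 * ln 2 / 8" for n
  have "(\<lambda>n. 5 / 2 * ln 2 - ln pi - (real n + 1) * (lnG (n + 2) + ln 2))
      \<longlonglongrightarrow> 5 / 2 * ln 2 - ln pi - D"
    by (intro tendsto_intros D)
  moreover have "\<forall>\<^sub>F n in sequentially.
      5 / 2 * ln 2 - ln pi - (real n + 1) * (lnG (n + 2) + ln 2) = F (n + 2) - F n"
    using eventually_ge_at_top[of 2]
  proof eventually_elim
    case (elim n)
    then show ?case
      using ln_C_BH_rec[of "n + 2"] by (simp add: F_def power2_eq_square field_simps)
  qed
  ultimately have "(\<lambda>n. F (n + 2) - F n) \<longlonglongrightarrow> 5 / 2 * ln 2 - ln pi - D"
    by (rule Lim_transform_eventually)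
  then have "(\<lambda>n. F n / real n) \<longlonglongrightarrow> (5 / 2 * ln 2 - ln pi - D) / 2"
    by (rule cesaro_two_step)
  moreover have "\<forall>\<^sub>F n in sequentially. F n / real n = ln (C_BH n) - real n * ln 2 / 8"
    using eventually_gt_at_top[of 0]
    by eventually_elim (simp add: F_def power2_eq_square field_simps)
  ultimately show ?thesis
    by (auto simp: convergent_def dest: Lim_transform_eventually)
qed

text \<open>The convergent sequence \<open>L\<close> runs through all integers, so its differences
  tend to 0 even between indices of opposite parity; only the linear term's ln 2 / 8
  survives.\<close>

lemma C_BH_ratio_limit: "(\<lambda>n. C_BH n / C_BH (n - 1)) \<longlonglongrightarrow> 2 powr (1 / 8)"
proof -
  define L where "L n = ln (C_BH n) - real n * ln 2 / 8" for n
  obtain b where b: "L \<longlonglongrightarrow> b"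
    using ln_C_BH_asymp unfolding convergent_def L_def by blast
  have "(\<lambda>n. exp (L (Suc n) - L n + ln 2 / 8)) \<longlonglongrightarrow> exp (b - b + ln 2 / 8)"
    by (intro tendsto_intros b LIMSEQ_Suc)
  moreover have "\<forall>\<^sub>F n in sequentially.
      exp (L (Suc n) - L n + ln 2 / 8) = C_BH (Suc n) / C_BH (Suc n - 1)"
    using eventually_ge_at_top[of 2]
  proof eventually_elim
    case (elim n)
    then have "C_BH (Suc n) > 0" "C_BH n > 0" by (auto intro: C_BH_pos)
    moreover have "L (Suc n) - L n + ln 2 / 8 = ln (C_BH (Suc n)) - ln (C_BH n)"
      by (simp add: L_def field_simps)
    ultimately show ?case by (simp add: exp_diff)
  qed
  ultimately have "(\<lambda>n. C_BH (Suc n) / C_BH (Suc n - 1)) \<longlonglongrightarrow> exp (b - b + ln 2 / 8)"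
    by (rule Lim_transform_eventually)
  then show ?thesis
    by (subst (asm) filterlim_sequentially_Suc) (simp add: powr_def)
qed

section \<open>Limits along the even integers\<close>

lemma even_at_top_neq_bot: "even_at_top \<noteq> bot"
proof -
  have "\<exists>n\<ge>N. even n" for N :: nat by (intro exI[of _ "2 * N"]) auto
  then show ?thesis
    by (auto simp: even_at_top_def trivial_limit_def eventually_inf_principal eventually_sequentially)
qed

theorem theorem3p3:
  shows "((\<exists>L. ((\<lambda>n. C_BH n / C_BH (n - 2)) \<longlongrightarrow> L) even_at_top) \<longleftrightarrow>
          (\<exists>L. ((\<lambda>n. r_seq n / r_seq (n - 2)) \<longlongrightarrow> L) even_at_top))
       \<and> ((\<exists>L. ((\<lambda>n. r_seq n / r_seq (n - 2)) \<longlongrightarrow> L) even_at_top) \<longrightarrow>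
            Lim even_at_top (\<lambda>n. C_BH n / C_BH (n - 2)) =
              2 powr (1 / 4) * Lim even_at_top (\<lambda>n. r_seq n / r_seq (n - 2)))
       \<and> ((\<exists>l. (r_seq \<longlongrightarrow> l) even_at_top) \<longrightarrow>
            (\<lambda>n. C_BH n / C_BH (n - 1)) \<longlonglongrightarrow> 2 powr (1 / 8))"
proof -
  let ?c = "\<lambda>n. C_BH n / C_BH (n - 2)" and ?r = "\<lambda>n. r_seq n / r_seq (n - 2)"
  let ?K = "2 powr (1 / 4) :: real"
  have eq: "\<forall>\<^sub>F n in even_at_top. ?c n = ?K * ?r n"
    unfolding even_at_top_def eventually_inf_principal
    using eventually_ge_at_top[of 4] by eventually_elim (blast intro: C_BH_ratio_even)
  then have c_iff: "(?c \<longlongrightarrow> L) even_at_top \<longleftrightarrow> ((\<lambda>n. ?K * ?r n) \<longlongrightarrow> L) even_at_top" for L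
    by (rule tendsto_cong)
  have r_to_c: "(?c \<longlongrightarrow> ?K * L) even_at_top" if "(?r \<longlongrightarrow> L) even_at_top" for L
    unfolding c_iff using that by (rule tendsto_mult_left)
  have c_to_r: "(?r \<longlongrightarrow> L / ?K) even_at_top" if "(?c \<longlongrightarrow> L) even_at_top" for L
    using tendsto_divide[OF that[unfolded c_iff] tendsto_const[of ?K]] by simp
  \<comment> \<open>Limits along a nontrivial filter are unique, so \<open>Lim\<close> evaluates to
    any limit that has been exhibited.\<close>
  have "Lim even_at_top ?c = ?K * Lim even_at_top ?r" if "(?r \<longlongrightarrow> L) even_at_top" for L
    using tendsto_Lim[OF even_at_top_neq_bot that]
      tendsto_Lim[OF even_at_top_neq_bot r_to_c[OF that]] by simp
  then show ?thesis
    using r_to_c c_to_r C_BH_ratio_limit by blast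
qed

end
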